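(* Let $A\in\mathbb{C}^{n\times n}$ and let $X_0\in\mathbb{C}^{n\times n}$ be invertible and commute with $A$. Put $t_0\equiv\frac12\|X_0^{-1}A-X_0\|$. If $$\sigma_{\min}(X_0)\ \ge\ \|X_0^{-1}A-X_0\|= 2t_0,$$ then the iteration $$X_{k+1}=\tfrac12\,(X_k+X_k^{-1}A),\quad k=0,1,2,\dots,$$ started with $X_0$ is meaningful and its sequence of iterates $\{X_k\}$ converges to a matrix $X_*\in\mathbb{C}^{n\times n}$ that commutes with $A$ and satisfies $X_*^2=A$. Moreover, with $$\gamma_0\equiv\sigma_{\min}^{1/2}(X_0)\,(\sigma_{\min}(X_0)-2t_0)^{1/2},\qquad \omega(t)=\frac12\,\frac{t^2}{(t^2+\gamma_0^2)^{1/2}},\qquad \sigma(t)=t-\gamma_0+(t^2+\gamma_0^2)^{1/2},$$ we have $$\|X_*-X_k\|\le\sigma(\omega^{(k)}(t_0)),\qquad k=0,1,2,\dots.$$ If $\gamma_0>0$, then $X_*$ is invertible with $\sigma_{\min}(X_* )\ge\gamma_0$.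
   Context: $\|\cdot\|$ denotes the spectral norm (operator 2-norm) on $\mathbb{C}^{n\times n}$, and $\sigma_{\min}(X)$ denotes the smallest singular value of $X$. The matrix $A$ may be singular. The iteration is called meaningful if all iterates are well defined and lie in the domain of the iteration map, i.e., every $X_k$, $k\ge0$, is invertible. $\omega^{(k)}$ denotes the $k$-th iterate of the function $\omega$: $\omega^{(0)}(t)=t$ and $\omega^{(k)}(t)=\omega(\omega^{(k-1)}(t))$ for $k\ge1$. The formulas for $\omega$ and $\sigma$ are used for $t>0$, and also at $t=0$ when $\gamma_0>0$ (if $t_0=0$, then $\gamma_0=\sigma_{\min}(X_0)>0$). *)

theory Defs
  imports "HOL-Analysis.Analysis"
begin

definition spectral_norm :: "complex^'n^'n \<Rightarrow> real" where
  "spectral_norm X = onorm ((*v) X)"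

definition conj_transpose :: "complex^'n^'n \<Rightarrow> complex^'n^'n" where
  "conj_transpose X = (\<chi> i j. cnj (X $ j $ i))"

text \<open>The singular values of \<open>X\<close> are the nonnegative square roots of the eigenvalues of
  \<open>X\<^sup>* X\<close>; this set is always finite and nonempty, so that \<open>Min\<close> is meaningful.\<close>

definition singular_values :: "complex^'n^'n \<Rightarrow> real set" where
  "singular_values X =
     {s. 0 \<le> s \<and> (\<exists>v. v \<noteq> 0 \<and> (conj_transpose X ** X) *v v = complex_of_real (s^2) *s v)}"

definition sigma_min :: "complex^'n^'n \<Rightarrow> real" where
  "sigma_min X = Min (singular_values X)"

text \<open>\<open>matrix_inv\<close> is unspecified on singular matrices, so the iteration is meaningful
  precisely when every \<open>newton_iter A X0 k\<close> is invertible.\<close>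

primrec newton_iter :: "complex^'n^'n \<Rightarrow> complex^'n^'n \<Rightarrow> nat \<Rightarrow> complex^'n^'n" where
  "newton_iter A X0 0 = X0"
| "newton_iter A X0 (Suc k) =
     (1/2) *\<^sub>R (newton_iter A X0 k + matrix_inv (newton_iter A X0 k) ** A)"

text \<open>The rate function \<open>\<omega>\<close> and the error function \<open>\<sigma>\<close>, with parameter \<open>\<gamma>\<^sub>0\<close> explicit.\<close>

definition rate_omega :: "real \<Rightarrow> real \<Rightarrow> real" where
  "rate_omega \<gamma>0 t = 1/2 * (t^2 / sqrt (t^2 + \<gamma>0^2))"

definition rate_sigma :: "real \<Rightarrow> real \<Rightarrow> real" where
  "rate_sigma \<gamma>0 t = t - \<gamma>0 + sqrt (t^2 + \<gamma>0^2)"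

end

theory Submission imports Defs begin

text \<open>
  Write \<open>H\<^sub>k = X\<^sub>k\<^sub>+\<^sub>1 - X\<^sub>k = \<onehalf>(X\<^sub>k\<inverse> A - X\<^sub>k)\<close> for the Newton corrections.  All iterates commute
  with \<open>A\<close>, so \<open>X\<^sub>k\<^sub>+\<^sub>1\<^sup>2 = A + H\<^sub>k\<^sup>2\<close> and therefore \<open>X\<^sub>k\<^sub>+\<^sub>1 H\<^sub>k\<^sub>+\<^sub>1 = -\<onehalf> H\<^sub>k\<^sup>2\<close>.  Hence the size of
  the next correction is controlled by that of the present one and by a lower bound for
  \<open>\<sigma>\<^sub>m\<^sub>i\<^sub>n(X\<^sub>k\<^sub>+\<^sub>1)\<close>, and the latter drops by at most the norm of \<open>H\<^sub>k\<close> in each step.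

  The scalar recursion matches these two estimates exactly.  Let \<open>t\<^sub>k = \<omega>\<^sup>(\<^sup>k\<^sup>)(t\<^sub>0)\<close> and
  \<open>s\<^sub>k = t\<^sub>k + (t\<^sub>k\<^sup>2 + \<gamma>\<^sub>0\<^sup>2)\<^sup>1\<^sup>/\<^sup>2\<close>.  Then \<open>s\<^sub>0 = \<sigma>\<^sub>m\<^sub>i\<^sub>n(X\<^sub>0)\<close> and \<open>s\<^sub>k\<^sub>+\<^sub>1 = s\<^sub>k - t\<^sub>k\<close>
  (\<open>majorant_rate_omega\<close>), and by induction \<open>H\<^sub>k\<close> has norm at most \<open>t\<^sub>k\<close> and \<open>X\<^sub>k\<close> is bounded
  below by \<open>s\<^sub>k > 0\<close> (\<open>newton_iter_invariant\<close>).  The errors telescope: \<open>X\<^sub>m - X\<^sub>k\<close> has norm at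
  most \<open>s\<^sub>k - s\<^sub>m\<close>, and \<open>s\<^sub>m \<ge> \<gamma>\<^sub>0\<close>, so that the sequence is Cauchy and its limit is at distance
  at most \<open>s\<^sub>k - \<gamma>\<^sub>0 = \<sigma>(t\<^sub>k)\<close> from \<open>X\<^sub>k\<close>.  Passing to the limit in \<open>X\<^sub>k\<^sub>+\<^sub>1\<^sup>2 = A + H\<^sub>k\<^sup>2\<close> gives the
  square root, and passing to the limit in the lower bounds gives the statement on
  \<open>\<sigma>\<^sub>m\<^sub>i\<^sub>n\<close> of the limit.

  Throughout, lower bounds on the smallest singular value are used in the form
  \<open>c \<parallel>v\<parallel> \<le> \<parallel>X v\<parallel>\<close> for all \<open>v\<close>; the equivalence is \<open>le_sigma_min_iff\<close>.
\<close>

section \<open>Matrix products as bounded bilinear maps\<close>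

lemma bounded_bilinear_matrix_mult:
  "bounded_bilinear ((**) :: complex^'n^'n \<Rightarrow> complex^'n^'n \<Rightarrow> complex^'n^'n)"
proof -
  have "bilinear ((**) :: complex^'n^'n \<Rightarrow> complex^'n^'n \<Rightarrow> complex^'n^'n)"
    unfolding bilinear_def
    by (auto intro!: linearI simp: matrix_matrix_mult_def vec_eq_iff algebra_simps
        sum.distrib scaleR_sum_right)
  then show ?thesis
    by (simp add: bilinear_conv_bounded_bilinear)
qed

lemma bounded_bilinear_matrix_vector:
  "bounded_bilinear ((*v) :: complex^'n^'n \<Rightarrow> complex^'n \<Rightarrow> complex^'n)"
proof -
  have "bilinear ((*v) :: complex^'n^'n \<Rightarrow> complex^'n \<Rightarrow> complex^'n)"
    unfolding bilinear_def
    by (auto intro!: linearI simp: matrix_vector_mult_def vec_eq_iff algebra_simps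
        sum.distrib scaleR_sum_right)
  then show ?thesis
    by (simp add: bilinear_conv_bounded_bilinear)
qed

interpretation mm: bounded_bilinear
  "(**) :: complex^'n^'n \<Rightarrow> complex^'n^'n \<Rightarrow> complex^'n^'n"
  by (rule bounded_bilinear_matrix_mult)

interpretation mv: bounded_bilinear
  "(*v) :: complex^'n^'n \<Rightarrow> complex^'n \<Rightarrow> complex^'n"
  by (rule bounded_bilinear_matrix_vector)

section \<open>The spectral norm\<close>

lemma norm_mult_vec_le_spectral:
  fixes X :: "complex^'n^'n"
  shows "norm (X *v v) \<le> spectral_norm X * norm v"
  unfolding spectral_norm_def by (rule onorm[OF mv.bounded_linear_right])

lemma spectral_norm_nonneg: "0 \<le> spectral_norm X"
  unfolding spectral_norm_def by (rule onorm_pos_le[OF mv.bounded_linear_right])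

lemma spectral_norm_le:
  fixes X :: "complex^'n^'n"
  assumes "\<And>v. norm (X *v v) \<le> c * norm v"
  shows "spectral_norm X \<le> c"
  unfolding spectral_norm_def
  by (rule onorm_le) (rule assms)

lemma norm_axis_one: "norm (axis j (1::complex) :: complex^'n) = 1"
  by (simp add: norm_eq_1 inner_axis_axis inner_complex_def)

text \<open>Convergence in the metric of the matrix type, which is the Euclidean one on the entries, is
  deduced from operator bounds with the following crude constant.\<close>

lemma norm_matrix_le_of_action:
  fixes X :: "complex^'n^'n"
  assumes "\<And>v. norm (X *v v) \<le> c * norm v"
  shows "norm X \<le> real (CARD('n) * CARD('n)) * c"
proof -
  have entry: "norm (X $ i $ j) \<le> c" for i j
  proof -
    have "norm (X $ i $ j) = norm ((X *v axis j 1) $ i)"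
      by (simp add: matrix_vector_mult_def axis_def if_distrib[of "\<lambda>x. _ * x"] cong: if_cong)
    also have "\<dots> \<le> norm (X *v axis j 1)"
      by (rule Finite_Cartesian_Product.norm_nth_le)
    also have "\<dots> \<le> c * norm (axis j (1::complex) :: complex^'n)"
      by (rule assms)
    finally show ?thesis by (simp add: norm_axis_one)
  qed
  have "norm X \<le> (\<Sum>i\<in>UNIV. norm (X $ i))"
    unfolding norm_vec_def[of X] by (rule L2_set_le_sum) simp
  also have "\<dots> \<le> (\<Sum>i\<in>UNIV. \<Sum>j\<in>UNIV. norm (X $ i $ j))"
    by (intro sum_mono) (unfold norm_vec_def, rule L2_set_le_sum, simp)
  also have "\<dots> \<le> (\<Sum>i\<in>(UNIV::'n set). \<Sum>j\<in>(UNIV::'n set). c)"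
    by (intro sum_mono entry)
  finally show ?thesis by simp
qed

section \<open>The smallest singular value\<close>

text \<open>The real inner product of \<open>complex^'n\<close> is the real part of the Hermitian one, so the
  conjugate transpose is also the adjoint for the real inner product.\<close>

lemma inner_conj_transpose:
  fixes X :: "complex^'n^'n"
  shows "(conj_transpose X *v x) \<bullet> y = x \<bullet> (X *v y)"
proof -
  have *: "(a * b) \<bullet> c = b \<bullet> (cnj a * c)" for a b c :: complex
    by (simp add: inner_complex_def algebra_simps)
  have "(conj_transpose X *v x) \<bullet> y = (\<Sum>i\<in>UNIV. \<Sum>j\<in>UNIV. x $ j \<bullet> (X $ j $ i * y $ i))"
    by (simp add: inner_vec_def matrix_vector_mult_def conj_transpose_def inner_sum_left *)
  also have "\<dots> = (\<Sum>j\<in>UNIV. \<Sum>i\<in>UNIV. x $ j \<bullet> (X $ j $ i * y $ i))"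
    by (rule sum.swap)
  also have "\<dots> = x \<bullet> (X *v y)"
    by (simp add: inner_vec_def matrix_vector_mult_def inner_sum_right)
  finally show ?thesis .
qed

lemma inner_gram:
  "((conj_transpose X ** X) *v x) \<bullet> y = (X *v x) \<bullet> (X *v y)"
  by (simp add: matrix_vector_mul_assoc[symmetric] inner_conj_transpose)

lemma of_real_smult_vec: "complex_of_real c *s v = c *\<^sub>R v"
  by (simp add: vec_eq_iff scaleR_conv_of_real[where 'a=complex])

lemma singular_values_alt:
  "singular_values X =
     {s. 0 \<le> s \<and> (\<exists>v. v \<noteq> 0 \<and> (conj_transpose X ** X) *v v = s^2 *\<^sub>R v)}"
  unfolding singular_values_def of_real_smult_vec ..

lemma singular_value_norm:
  assumes "s \<in> singular_values X"
  obtains v where "v \<noteq> 0" "norm (X *v v) = s * norm v"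
proof -
  obtain v where s: "0 \<le> s" and v: "v \<noteq> 0" "(conj_transpose X ** X) *v v = s^2 *\<^sub>R v"
    using assms unfolding singular_values_alt by auto
  have "(norm (X *v v))^2 = (s * norm v)^2"
    using inner_gram[of X v v] v(2) by (simp add: power2_norm_eq_inner power_mult_distrib)
  then have "norm (X *v v) = s * norm v"
    using s by (simp add: power2_eq_iff_nonneg)
  with v(1) show thesis by (rule that)
qed

text \<open>Eigenvectors of \<open>X\<^sup>* X\<close> for different singular values are orthogonal, so there are only
  finitely many singular values.\<close>

lemma finite_singular_values:
  fixes X :: "complex^'n^'n"
  shows "finite (singular_values X)"
proof -
  let ?S = "singular_values X"
  have "\<forall>s\<in>?S. \<exists>v. v \<noteq> 0 \<and> (conj_transpose X ** X) *v v = s^2 *\<^sub>R v"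
    by (auto simp: singular_values_alt)
  then obtain e where
    e: "\<And>s. s \<in> ?S \<Longrightarrow> e s \<noteq> 0 \<and> (conj_transpose X ** X) *v e s = s^2 *\<^sub>R e s"
    by metis
  have orth: "e s \<bullet> e r = 0" if "s \<in> ?S" "r \<in> ?S" "s \<noteq> r" for s r
  proof -
    have "s^2 * (e s \<bullet> e r) = (X *v e s) \<bullet> (X *v e r)"
      using inner_gram[of X "e s" "e r"] e[OF that(1)] by simp
    also have "\<dots> = r^2 * (e s \<bullet> e r)"
      using inner_gram[of X "e r" "e s"] e[OF that(2)] by (simp add: inner_commute)
    finally have "s^2 * (e s \<bullet> e r) = r^2 * (e s \<bullet> e r)" .
    moreover have "s^2 \<noteq> r^2"
      using that by (simp add: singular_values_alt power2_eq_iff_nonneg)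
    ultimately show ?thesis by simp
  qed
  have inj: "inj_on e ?S"
  proof (rule inj_onI)
    fix s r assume sr: "s \<in> ?S" "r \<in> ?S" "e s = e r"
    show "s = r"
      using orth[OF sr(1,2)] e[OF sr(1)] sr(3) by auto
  qed
  have "pairwise orthogonal (e ` ?S)"
    by (auto simp: pairwise_def orthogonal_def intro: orth)
  moreover have "0 \<notin> e ` ?S"
    using e by force
  ultimately have "independent (e ` ?S)"
    by (rule pairwise_orthogonal_independent)
  then have "finite (e ` ?S)"
    by (rule independent_imp_finite)
  then show ?thesis
    using inj finite_imageD by blast
qed

text \<open>The minimum of \<open>\<parallel>X v\<parallel>\<close> over the unit sphere is a singular value: a minimiser is a critical
  point of the quadratic form, hence an eigenvector of \<open>X\<^sup>* X\<close>.\<close>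

lemma min_norm_singular_value:
  fixes X :: "complex^'n^'n"
  obtains m where "m \<in> singular_values X" "\<And>v. m * norm v \<le> norm (X *v v)"
proof -
  let ?S = "sphere (0 :: complex^'n) 1"
  have "compact ?S" by simp
  moreover have "axis undefined 1 \<in> ?S"
    by (simp add: norm_axis_one)
  then have "?S \<noteq> {}" by blast
  moreover have "continuous_on ?S (\<lambda>v. norm (X *v v))"
    by (intro continuous_on_norm linear_continuous_on mv.bounded_linear_right)
  ultimately obtain w where w: "w \<in> ?S" and wmin: "\<And>v. v \<in> ?S \<Longrightarrow> norm (X *v w) \<le> norm (X *v v)"
    using continuous_attains_inf[of ?S "\<lambda>v. norm (X *v v)"] by blast
  define m where "m = norm (X *v w)"
  have low: "m * norm v \<le> norm (X *v v)" for v
  proof (cases "v = 0")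
    case False
    then have "m \<le> norm (X *v ((1 / norm v) *\<^sub>R v))"
      unfolding m_def by (intro wmin) simp
    also have "\<dots> = norm (X *v v) / norm v"
      by (simp add: mv.scaleR_right)
    finally show ?thesis
      using False by (simp add: field_simps)
  qed simp
  define q where "q v = (X *v v) \<bullet> (X *v v) - m^2 * (v \<bullet> v)" for v
  have q_nonneg: "0 \<le> q v" for v
  proof -
    have "(m * norm v)^2 \<le> (norm (X *v v))^2"
      by (intro power_mono low) (simp add: m_def)
    then show ?thesis
      by (simp add: q_def power2_norm_eq_inner power_mult_distrib)
  qed
  have ww: "w \<bullet> w = 1"
    using w by (simp add: power2_norm_eq_inner[symmetric])
  have qw: "q w = 0"
    by (simp add: q_def ww m_def power2_norm_eq_inner)
  define u where "u = (conj_transpose X ** X) *v w - m^2 *\<^sub>R w"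
  have expand: "q (w + t *\<^sub>R u) = 2 * t * (u \<bullet> u) + t^2 * q u" for t
  proof -
    have "q (w + t *\<^sub>R u) = q w + 2 * t * ((X *v w) \<bullet> (X *v u) - m^2 * (w \<bullet> u)) + t^2 * q u"
      by (simp add: q_def mv.add_right mv.scaleR_right inner_add_left inner_add_right
          inner_commute algebra_simps power2_eq_square)
    moreover have "(X *v w) \<bullet> (X *v u) - m^2 * (w \<bullet> u) = u \<bullet> u"
      unfolding inner_gram[symmetric] by (simp add: u_def inner_diff_left)
    ultimately show ?thesis
      by (simp add: qw)
  qed
  have "u = 0"
  proof (rule ccontr)
    assume "u \<noteq> 0"
    \<comment> \<open>\<open>q (w + t u)\<close> has slope \<open>2 (u \<bullet> u) > 0\<close> at \<open>t = 0\<close>, so it is negative for a small negative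
      \<open>t\<close>; the step \<open>- (u \<bullet> u) / (q u + 1)\<close> is such a \<open>t\<close> even if \<open>q u = 0\<close>.\<close>
    define a b where "a = u \<bullet> u" and "b = q u + 1"
    have a: "a > 0" and b: "b > 0"
      using \<open>u \<noteq> 0\<close> q_nonneg[of u] by (auto simp: a_def b_def)
    have "0 \<le> 2 * (- a / b) * a + (- a / b)^2 * (b - 1)"
      using q_nonneg[of "w + (- a / b) *\<^sub>R u", unfolded expand] by (simp add: a_def b_def)
    also have "\<dots> = - (a^2 * (b + 1)) / b^2"
      using b by (simp add: field_simps power2_eq_square)
    also have "\<dots> < 0"
      using a b by (simp add: divide_neg_pos)
    finally show False by simp
  qed
  moreover have "w \<noteq> 0" "0 \<le> m"
    using ww by (auto simp: m_def)
  ultimately have "m \<in> singular_values X"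
    by (auto simp: singular_values_alt u_def)
  with low show thesis
    using that by blast
qed

lemma sigma_min_in_singular_values: "sigma_min X \<in> singular_values X"
  unfolding sigma_min_def
  using finite_singular_values[of X] min_norm_singular_value[of X] by (metis Min_in empty_iff)

lemma sigma_min_mult_norm_le: "sigma_min X * norm v \<le> norm (X *v v)"
proof -
  obtain m where m: "m \<in> singular_values X" "\<And>v. m * norm v \<le> norm (X *v v)"
    using min_norm_singular_value by blast
  have "sigma_min X \<le> m"
    unfolding sigma_min_def using m(1) by (simp add: finite_singular_values)
  then have "sigma_min X * norm v \<le> m * norm v"
    by (simp add: mult_right_mono)
  with m(2)[of v] show ?thesis by simp
qed

lemma le_sigma_min_iff: "c \<le> sigma_min X \<longleftrightarrow> (\<forall>v. c * norm v \<le> norm (X *v v))"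
proof
  assume "c \<le> sigma_min X"
  then have "c * norm v \<le> sigma_min X * norm v" for v :: "complex^'a"
    by (simp add: mult_right_mono)
  then show "\<forall>v. c * norm v \<le> norm (X *v v)"
    using sigma_min_mult_norm_le order_trans by blast
next
  assume *: "\<forall>v. c * norm v \<le> norm (X *v v)"
  obtain v where "v \<noteq> 0" "norm (X *v v) = sigma_min X * norm v"
    using singular_value_norm[OF sigma_min_in_singular_values] by blast
  with *[rule_format, of v] show "c \<le> sigma_min X" by simp
qed

lemma invertible_of_norm_lower_bound:
  fixes X :: "complex^'n^'n"
  assumes "c > 0" "\<And>v. c * norm v \<le> norm (X *v v)"
  shows "invertible X"
proof -
  have "v = 0" if "X *v v = 0" for v
    using assms(1) assms(2)[of v] that by (simp add: mult_le_0_iff)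
  then have "\<exists>B. B ** X = mat 1"
    by (simp add: matrix_left_invertible_ker)
  then show ?thesis
    by (simp add: invertible_left_inverse)
qed

lemma sigma_min_pos:
  assumes "invertible X"
  shows "0 < sigma_min X"
proof -
  obtain v where v: "v \<noteq> 0" "norm (X *v v) = sigma_min X * norm v"
    using singular_value_norm[OF sigma_min_in_singular_values] by blast
  have "X *v v \<noteq> 0"
    using assms v(1) by (metis invertible_left_inverse matrix_left_invertible_ker)
  then have "sigma_min X * norm v > 0"
    using v(2) by (metis zero_less_norm_iff)
  then show ?thesis
    using v(1) by (simp add: zero_less_mult_iff)
qed

section \<open>One Newton step\<close>

text \<open>The increment that a Newton step adds to \<open>X\<close>.\<close>

definition newton_corr :: "complex^'n^'n \<Rightarrow> complex^'n^'n \<Rightarrow> complex^'n^'n" where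
  "newton_corr A X = (1/2) *\<^sub>R (matrix_inv X ** A - X)"

lemma newton_iter_Suc_corr:
  fixes A X0 :: "complex^'n^'n"
  shows "newton_iter A X0 (Suc k) = newton_iter A X0 k + newton_corr A (newton_iter A X0 k)"
proof -
  have "(1/2) *\<^sub>R (X + Y) = X + (1/2) *\<^sub>R (Y - X)" for X Y :: "complex^'n^'n"
    by (simp add: vec_eq_iff scaleR_conv_of_real[where 'a=complex] field_simps)
  then show ?thesis
    by (simp add: newton_corr_def)
qed

lemma
  fixes X :: "complex^'n^'n"
  assumes "invertible X"
  shows matrix_inv_right: "X ** matrix_inv X = mat 1"
    and matrix_inv_left: "matrix_inv X ** X = mat 1"
proof -
  have "X ** matrix_inv X = mat 1 \<and> matrix_inv X ** X = mat 1"
    unfolding matrix_inv_def using assms unfolding invertible_def by (rule someI_ex)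
  then show "X ** matrix_inv X = mat 1" "matrix_inv X ** X = mat 1"
    by simp_all
qed

lemma matrix_inv_mult_commute:
  fixes X A :: "complex^'n^'n"
  assumes inv: "invertible X" and comm: "X ** A = A ** X"
  shows "matrix_inv X ** A = A ** matrix_inv X"
proof -
  let ?Y = "matrix_inv X"
  have "?Y ** A = ?Y ** A ** (X ** ?Y)"
    using inv by (simp add: matrix_inv_right)
  also have "\<dots> = ?Y ** (A ** X) ** ?Y"
    by (simp add: matrix_mul_assoc)
  also have "\<dots> = (?Y ** X) ** A ** ?Y"
    by (simp add: comm[symmetric] matrix_mul_assoc)
  also have "\<dots> = A ** ?Y"
    using inv by (simp add: matrix_inv_left)
  finally show ?thesis .
qed

lemma newton_corr_commute:
  fixes X A :: "complex^'n^'n"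
  assumes "invertible X" "X ** A = A ** X"
  shows "newton_corr A X ** A = A ** newton_corr A X"
proof -
  have "matrix_inv X ** A ** A = A ** (matrix_inv X ** A)"
    unfolding matrix_inv_mult_commute[OF assms]
    by (simp only: matrix_mul_assoc[symmetric] matrix_inv_mult_commute[OF assms])
  then show ?thesis
    by (simp add: newton_corr_def mm.scaleR_left mm.scaleR_right mm.diff_left mm.diff_right
        assms(2))
qed

lemma mult_newton_corr:
  fixes X A :: "complex^'n^'n"
  assumes "invertible X"
  shows "X ** newton_corr A X = (1/2) *\<^sub>R (A - X ** X)"
  unfolding newton_corr_def
  by (simp add: mm.scaleR_right mm.diff_right matrix_mul_assoc matrix_inv_right[OF assms])

lemma newton_corr_mult:
  fixes X A :: "complex^'n^'n"
  assumes "invertible X" "X ** A = A ** X"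
  shows "newton_corr A X ** X = (1/2) *\<^sub>R (A - X ** X)"
proof -
  have "matrix_inv X ** A ** X = A"
    by (simp add: matrix_mul_assoc[symmetric] assms(2)[symmetric])
      (simp add: matrix_mul_assoc matrix_inv_left[OF assms(1)])
  then show ?thesis
    by (simp add: newton_corr_def mm.scaleR_left mm.diff_left)
qed

text \<open>The square of the new iterate misses \<open>A\<close> by exactly the square of the correction, because
  \<open>X H = H X = \<onehalf> (A - X\<^sup>2)\<close>.\<close>

lemma newton_step_square:
  fixes X A :: "complex^'n^'n"
  assumes "invertible X" "X ** A = A ** X"
  defines "H \<equiv> newton_corr A X"
  shows "(X + H) ** (X + H) = A + H ** H"
proof -
  have "(X + H) ** (X + H) = X ** X + X ** H + H ** X + H ** H"
    by (simp add: mm.add_left mm.add_right algebra_simps)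
  also have "\<dots> = X ** X + ((1/2) *\<^sub>R (A - X ** X) + (1/2) *\<^sub>R (A - X ** X)) + H ** H"
    unfolding H_def mult_newton_corr[OF assms(1)] newton_corr_mult[OF assms(1,2)]
    by (simp only: add.assoc)
  also have "\<dots> = A + H ** H"
    by (simp add: scaleR_left_distrib[symmetric])
  finally show ?thesis .
qed

section \<open>The scalar majorant\<close>

text \<open>The lower bound that is maintained for the smallest singular value of an iterate whose
  correction has norm at most \<open>t\<close>.\<close>

definition majorant :: "real \<Rightarrow> real \<Rightarrow> real" where
  "majorant \<gamma> t = t + sqrt (t^2 + \<gamma>^2)"

lemma rate_sigma_majorant: "rate_sigma \<gamma> t = majorant \<gamma> t - \<gamma>"
  by (simp add: rate_sigma_def majorant_def)

lemma majorant_ge: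
  assumes "0 \<le> t"
  shows "\<gamma> \<le> majorant \<gamma> t"
proof -
  have "\<gamma> \<le> sqrt (t^2 + \<gamma>^2)"
    by (rule real_le_rsqrt) simp
  with assms show ?thesis
    unfolding majorant_def by linarith
qed

lemma rate_omega_nonneg: "0 \<le> rate_omega \<gamma> t"
  by (simp add: rate_omega_def)

lemma rate_omega_pos:
  assumes "0 < t"
  shows "0 < rate_omega \<gamma> t"
  using assms by (simp add: rate_omega_def add_pos_nonneg)

text \<open>Since \<open>(t\<^sup>2 + \<gamma>\<^sup>2)\<^sup>1\<^sup>/\<^sup>2 = majorant \<gamma> t - t\<close>, replacing \<open>t\<close> by \<open>\<omega>(t)\<close> lowers the majorant by
  exactly \<open>t\<close>; this is what makes the error bounds telescope.\<close>

lemma majorant_rate_omega: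
  assumes "0 < t^2 + \<gamma>^2"
  shows "majorant \<gamma> (rate_omega \<gamma> t) = sqrt (t^2 + \<gamma>^2)"
proof -
  define s where "s = sqrt (t^2 + \<gamma>^2)"
  define w where "w = rate_omega \<gamma> t"
  have s: "s > 0" and s2: "s^2 = t^2 + \<gamma>^2"
    using assms by (simp_all add: s_def)
  have ws: "2 * w * s = t^2"
    using s by (simp add: w_def rate_omega_def s_def[symmetric])
  have "w^2 + \<gamma>^2 = (s - w)^2"
    using s2 ws by (simp add: power2_eq_square algebra_simps)
  moreover have "w \<le> s"
  proof -
    have "2 * w * s \<le> s * s"
      using ws s2 by (simp add: power2_eq_square[symmetric])
    then have "2 * w \<le> s"
      using s by simp
    moreover have "0 \<le> w"
      by (simp add: w_def rate_omega_nonneg)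
    ultimately show ?thesis by simp
  qed
  ultimately have "sqrt (w^2 + \<gamma>^2) = s - w"
    by simp
  then show ?thesis
    by (simp add: majorant_def w_def[symmetric] s_def[symmetric])
qed

section \<open>Invariants of the iteration and convergence\<close>

text \<open>The state of the iteration at an iterate \<open>X\<close>: the Newton correction at \<open>X\<close> has spectral norm
  at most \<open>t\<close>, and \<open>majorant \<gamma> t\<close> is a lower bound for the smallest singular value of \<open>X\<close>.  The
  condition \<open>0 < \<gamma> \<or> 0 < t\<close> guarantees \<open>0 < majorant \<gamma> t\<close> also in the borderline case
  \<open>\<gamma> = 0\<close>, where the lower bounds tend to zero but every iterate is still invertible.\<close>

definition newton_bound :: "real \<Rightarrow> complex^'n^'n \<Rightarrow> complex^'n^'n \<Rightarrow> real \<Rightarrow> bool" where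
  "newton_bound \<gamma> A X t \<longleftrightarrow>
     invertible X \<and> X ** A = A ** X \<and> 0 \<le> t \<and> (0 < \<gamma> \<or> 0 < t) \<and>
     (\<forall>v. majorant \<gamma> t * norm v \<le> norm (X *v v)) \<and>
     (\<forall>v. norm (newton_corr A X *v v) \<le> t * norm v)"

text \<open>With \<open>s = (t\<^sup>2 + \<gamma>\<^sup>2)\<^sup>1\<^sup>/\<^sup>2\<close>, the lower bound \<open>t + s\<close> for \<open>X\<close> leaves \<open>s\<close> for \<open>X + H\<close>; the
  next correction, multiplied by \<open>X + H\<close>, is \<open>-\<onehalf> H\<^sup>2\<close> and therefore has norm at most
  \<open>t\<^sup>2 / (2 s)\<close>, which is \<open>\<omega>(t)\<close>.\<close>

lemma newton_bound_step:
  fixes A X :: "complex^'n^'n"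
  assumes "newton_bound \<gamma> A X t"
  shows "newton_bound \<gamma> A (X + newton_corr A X) (rate_omega \<gamma> t)"
proof -
  define H where "H = newton_corr A X"
  define s where "s = sqrt (t^2 + \<gamma>^2)"
  have inv: "invertible X" and comm: "X ** A = A ** X" and t: "0 \<le> t"
    and pos: "0 < \<gamma> \<or> 0 < t"
    and low: "\<And>v. (t + s) * norm v \<le> norm (X *v v)"
    and upp: "\<And>v. norm (H *v v) \<le> t * norm v"
    using assms unfolding newton_bound_def H_def s_def majorant_def by auto
  have sq: "0 < t^2 + \<gamma>^2"
    using pos by (auto simp: add_pos_nonneg add_nonneg_pos)
  then have s: "0 < s" by (simp add: s_def)
  have maj: "majorant \<gamma> (rate_omega \<gamma> t) = s"
    using majorant_rate_omega[OF sq] by (simp add: s_def)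
  have low': "s * norm v \<le> norm ((X + H) *v v)" for v
  proof -
    have "norm (X *v v) \<le> norm ((X + H) *v v) + norm (H *v v)"
      using norm_triangle_ineq4[of "(X + H) *v v" "H *v v"] by (simp add: mv.add_left)
    with low[of v] upp[of v] show ?thesis by (simp add: algebra_simps)
  qed
  have inv': "invertible (X + H)"
    using s low' by (rule invertible_of_norm_lower_bound)
  have comm': "(X + H) ** A = A ** (X + H)"
    using comm newton_corr_commute[OF inv comm]
    by (simp add: H_def mm.add_left mm.add_right)
  have corr': "(X + H) ** newton_corr A (X + H) = (- 1/2) *\<^sub>R (H ** H)"
    unfolding mult_newton_corr[OF inv'] using newton_step_square[OF inv comm]
    by (simp add: H_def)
  have upp': "norm (newton_corr A (X + H) *v v) \<le> rate_omega \<gamma> t * norm v" for v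
  proof -
    have "s * norm (newton_corr A (X + H) *v v) \<le> norm ((X + H) *v (newton_corr A (X + H) *v v))"
      by (rule low')
    also have "\<dots> = norm (H *v (H *v v)) / 2"
      by (simp add: matrix_vector_mul_assoc corr' mv.minus_left mv.scaleR_left)
    also have "\<dots> \<le> t * (t * norm v) / 2"
      using upp[of "H *v v"] mult_left_mono[OF upp[of v] t] by simp
    finally have "norm (newton_corr A (X + H) *v v) \<le> (t * (t * norm v) / 2) / s"
      using s by (simp add: field_simps)
    also have "\<dots> = rate_omega \<gamma> t * norm v"
      unfolding rate_omega_def s_def[symmetric] by (simp add: power2_eq_square)
    finally show ?thesis .
  qed
  have "0 < \<gamma> \<or> 0 < rate_omega \<gamma> t"
    using pos rate_omega_pos by blast
  with inv' comm' low' upp' show ?thesis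
    unfolding newton_bound_def H_def[symmetric] maj by (simp add: rate_omega_nonneg)
qed

lemma newton_iter_invariant:
  assumes "newton_bound \<gamma> A X0 t0"
  shows "newton_bound \<gamma> A (newton_iter A X0 k) ((rate_omega \<gamma> ^^ k) t0)"
proof (induction k)
  case 0
  then show ?case using assms by simp
next
  case (Suc k)
  then show ?case
    using newton_bound_step by (simp only: newton_iter_Suc_corr funpow.simps comp_apply)
qed

lemma newton_iter_diff_bound:
  fixes A X0 :: "complex^'n^'n"
  assumes "newton_bound \<gamma> A X0 t0"
  defines "s \<equiv> \<lambda>k. majorant \<gamma> ((rate_omega \<gamma> ^^ k) t0)"
  shows "norm ((newton_iter A X0 (k + d) - newton_iter A X0 k) *v v) \<le> (s k - s (k + d)) * norm v"
proof (induction d)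
  case 0
  then show ?case by simp
next
  case (Suc d)
  let ?X = "newton_iter A X0" and ?t = "(rate_omega \<gamma> ^^ (k + d)) t0"
  have b: "newton_bound \<gamma> A (?X (k + d)) ?t"
    using assms(1) by (rule newton_iter_invariant)
  then have "0 < ?t^2 + \<gamma>^2"
    by (auto simp: newton_bound_def add_pos_nonneg add_nonneg_pos)
  then have step: "s (k + Suc d) = s (k + d) - ?t"
    by (simp add: s_def majorant_rate_omega) (simp add: majorant_def)
  have "?X (k + Suc d) - ?X k = (?X (k + d) - ?X k) + newton_corr A (?X (k + d))"
    unfolding add_Suc_right newton_iter_Suc_corr by simp
  then have "norm ((?X (k + Suc d) - ?X k) *v v)
      \<le> norm ((?X (k + d) - ?X k) *v v) + norm (newton_corr A (?X (k + d)) *v v)"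
    by (simp only: mv.add_left norm_triangle_ineq)
  also have "\<dots> \<le> (s k - s (k + d)) * norm v + ?t * norm v"
    using Suc.IH b by (intro add_mono) (simp_all add: newton_bound_def)
  also have "\<dots> = (s k - s (k + Suc d)) * norm v"
    unfolding step by (simp only: algebra_simps)
  finally show ?case .
qed

lemma newton_iter_convergent:
  fixes A X0 :: "complex^'n^'n"
  assumes bound: "newton_bound \<gamma> A X0 t0"
  shows "convergent (newton_iter A X0)"
proof -
  let ?X = "newton_iter A X0"
  define s where "s k = majorant \<gamma> ((rate_omega \<gamma> ^^ k) t0)" for k
  define N where "N = real (CARD('n) * CARD('n))"
  have N: "N > 0" by (simp add: N_def)
  have diff: "norm (?X (k + d) - ?X k) \<le> N * (s k - s (k + d))" for k d
    unfolding N_def s_def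
    by (intro norm_matrix_le_of_action newton_iter_diff_bound bound)
  have "decseq s"
  proof (rule decseq_SucI)
    fix k
    have "0 \<le> N * (s k - s (k + 1))"
      using diff[of k 1] norm_ge_zero order_trans by blast
    then show "s (Suc k) \<le> s k"
      using N by (simp add: zero_le_mult_iff)
  qed
  moreover have "\<gamma> \<le> s k" for k
    using newton_iter_invariant[OF bound, of k]
    by (simp add: s_def majorant_ge newton_bound_def)
  ultimately have "convergent s"
    using decseq_convergent convergentI by metis
  then have "Cauchy s"
    by (rule convergent_Cauchy)
  have "Cauchy ?X"
  proof (rule CauchyI')
    fix e :: real assume "0 < e"
    then obtain M where M: "\<And>m n. m \<ge> M \<Longrightarrow> n \<ge> M \<Longrightarrow> norm (s m - s n) < e / N"
      using CauchyD[OF \<open>Cauchy s\<close>, of "e / N"] N by auto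
    show "\<exists>M. \<forall>m\<ge>M. \<forall>n>m. dist (?X m) (?X n) < e"
    proof (intro exI[of _ M] allI impI)
      fix m n assume mn: "M \<le> m" "m < n"
      have "dist (?X m) (?X n) \<le> N * (s m - s n)"
        using diff[of m "n - m"] mn by (simp add: dist_norm norm_minus_commute)
      also have "s m - s n < e / N"
        using M[of m n] mn by simp
      then have "N * (s m - s n) < e"
        using N by (simp add: field_simps)
      finally show "dist (?X m) (?X n) < e" .
    qed
  qed
  then show ?thesis
    by (rule Cauchy_convergent)
qed

lemma newton_bound_initial:
  fixes A X0 :: "complex^'n^'n"
  assumes inv: "invertible X0" and comm: "X0 ** A = A ** X0"
    and t0: "t0 = 1/2 * spectral_norm (matrix_inv X0 ** A - X0)"
    and le: "sigma_min X0 \<ge> spectral_norm (matrix_inv X0 ** A - X0)"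
    and \<gamma>: "\<gamma> = sqrt (sigma_min X0) * sqrt (sigma_min X0 - 2 * t0)"
  shows "newton_bound \<gamma> A X0 t0"
proof -
  define \<sigma> where "\<sigma> = sigma_min X0"
  have \<sigma>: "0 < \<sigma>"
    using sigma_min_pos[OF inv] by (simp add: \<sigma>_def)
  have t0_nonneg: "0 \<le> t0"
    by (simp add: t0 spectral_norm_nonneg)
  have le': "2 * t0 \<le> \<sigma>"
    using le by (simp add: t0 \<sigma>_def)
  have "\<gamma>^2 = \<sigma> * (\<sigma> - 2 * t0)"
    using \<sigma> le' by (simp add: \<gamma> \<sigma>_def[symmetric] power_mult_distrib)
  \<comment> \<open>\<open>\<gamma>\<close> is the value for which the majorant at \<open>t0\<close> equals the smallest singular value.\<close>
  then have "t0^2 + \<gamma>^2 = (\<sigma> - t0)^2"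
    by (simp add: power2_eq_square algebra_simps)
  then have maj: "majorant \<gamma> t0 = \<sigma>"
    using le' t0_nonneg by (simp add: majorant_def)
  have pos: "0 < \<gamma> \<or> 0 < t0"
  proof (cases "t0 = 0")
    case True
    then show ?thesis using \<sigma> by (simp add: \<gamma> \<sigma>_def[symmetric])
  next
    case False
    then show ?thesis using t0_nonneg by simp
  qed
  have corr: "norm (newton_corr A X0 *v v) \<le> t0 * norm v" for v
    using norm_mult_vec_le_spectral[of "matrix_inv X0 ** A - X0" v]
    by (simp add: newton_corr_def mv.scaleR_left t0)
  have "\<forall>v. \<sigma> * norm v \<le> norm (X0 *v v)"
    by (simp add: \<sigma>_def sigma_min_mult_norm_le)
  with inv comm t0_nonneg pos corr show ?thesis
    by (simp add: newton_bound_def maj)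
qed

theorem theorem4p1:
  fixes A X0 :: "complex^'n^'n" and t0 \<gamma>0 :: real
  assumes "invertible X0"
    and "X0 ** A = A ** X0"
    and "t0 = 1/2 * spectral_norm (matrix_inv X0 ** A - X0)"
    and "sigma_min X0 \<ge> spectral_norm (matrix_inv X0 ** A - X0)"
    and "\<gamma>0 = sqrt (sigma_min X0) * sqrt (sigma_min X0 - 2 * t0)"
  shows "(\<forall>k. invertible (newton_iter A X0 k)) \<and>
    (\<exists>Xs. newton_iter A X0 \<longlonglongrightarrow> Xs \<and>
      Xs ** A = A ** Xs \<and>
      Xs ** Xs = A \<and>
      (\<forall>k. spectral_norm (Xs - newton_iter A X0 k)
             \<le> rate_sigma \<gamma>0 ((rate_omega \<gamma>0 ^^ k) t0)) \<and>
      (\<gamma>0 > 0 \<longrightarrow> invertible Xs \<and> sigma_min Xs \<ge> \<gamma>0))"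
proof -
  let ?X = "newton_iter A X0"
  define \<tau> where "\<tau> k = (rate_omega \<gamma>0 ^^ k) t0" for k
  have init: "newton_bound \<gamma>0 A X0 t0"
    using assms by (rule newton_bound_initial)
  have bound: "newton_bound \<gamma>0 A (?X k) (\<tau> k)" for k
    unfolding \<tau>_def using init by (rule newton_iter_invariant)
  have inv: "invertible (?X k)" and comm: "?X k ** A = A ** ?X k"
    and \<tau>_nonneg: "0 \<le> \<tau> k" for k
    using bound[of k] by (simp_all add: newton_bound_def)
  obtain Xs where lim: "?X \<longlonglongrightarrow> Xs"
    using newton_iter_convergent[OF init] by (auto simp: convergent_def)
  have lim_Suc: "(\<lambda>k. ?X (Suc k)) \<longlonglongrightarrow> Xs"
    using lim by (rule LIMSEQ_Suc)

  have "(\<lambda>k. ?X k ** A) \<longlonglongrightarrow> Xs ** A"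
    by (intro mm.tendsto lim tendsto_const)
  moreover have "(\<lambda>k. ?X k ** A) \<longlonglongrightarrow> A ** Xs"
    unfolding comm by (intro mm.tendsto lim tendsto_const)
  ultimately have Xs_comm: "Xs ** A = A ** Xs"
    by (rule LIMSEQ_unique)

  have Xs_square: "Xs ** Xs = A"
  proof -
    have "?X (Suc k) ** ?X (Suc k) = A + (?X (Suc k) - ?X k) ** (?X (Suc k) - ?X k)" for k
      using newton_step_square[OF inv comm, of k]
      by (simp only: newton_iter_Suc_corr add_diff_cancel_left')
    moreover have "(\<lambda>k. A + (?X (Suc k) - ?X k) ** (?X (Suc k) - ?X k))
        \<longlonglongrightarrow> A + (Xs - Xs) ** (Xs - Xs)"
      by (intro tendsto_add tendsto_const mm.tendsto tendsto_diff lim lim_Suc)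
    ultimately have "(\<lambda>k. ?X (Suc k) ** ?X (Suc k)) \<longlonglongrightarrow> A"
      by (simp only: diff_self mm.zero_left add_0_right)
    moreover have "(\<lambda>k. ?X (Suc k) ** ?X (Suc k)) \<longlonglongrightarrow> Xs ** Xs"
      by (intro mm.tendsto lim_Suc)
    ultimately show ?thesis
      by (rule LIMSEQ_unique[symmetric])
  qed

  have error: "spectral_norm (Xs - ?X k) \<le> rate_sigma \<gamma>0 (\<tau> k)" for k
  proof (rule spectral_norm_le)
    fix v
    have "(\<lambda>d. ?X (k + d)) \<longlonglongrightarrow> Xs"
      using LIMSEQ_ignore_initial_segment[OF lim, of k] by (simp add: add.commute)
    then have "(\<lambda>d. norm ((?X (k + d) - ?X k) *v v)) \<longlonglongrightarrow> norm ((Xs - ?X k) *v v)"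
      by (intro tendsto_norm mv.tendsto tendsto_diff tendsto_const)
    moreover have "norm ((?X (k + d) - ?X k) *v v) \<le> rate_sigma \<gamma>0 (\<tau> k) * norm v" for d
    proof -
      have "norm ((?X (k + d) - ?X k) *v v)
          \<le> (majorant \<gamma>0 (\<tau> k) - majorant \<gamma>0 (\<tau> (k + d))) * norm v"
        unfolding \<tau>_def using init by (rule newton_iter_diff_bound)
      also have "\<dots> \<le> rate_sigma \<gamma>0 (\<tau> k) * norm v"
        using majorant_ge[OF \<tau>_nonneg, of \<gamma>0 "k + d"]
        by (intro mult_right_mono) (simp_all add: rate_sigma_majorant)
      finally show ?thesis .
    qed
    ultimately show "norm ((Xs - ?X k) *v v) \<le> rate_sigma \<gamma>0 (\<tau> k) * norm v"
      by (intro LIMSEQ_le_const2) auto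
  qed

  have low: "\<gamma>0 * norm v \<le> norm (Xs *v v)" for v
  proof -
    have "(\<lambda>k. norm (?X k *v v)) \<longlonglongrightarrow> norm (Xs *v v)"
      by (intro tendsto_norm mv.tendsto lim tendsto_const)
    moreover have "\<gamma>0 * norm v \<le> norm (?X k *v v)" for k
    proof -
      have "\<gamma>0 * norm v \<le> majorant \<gamma>0 (\<tau> k) * norm v"
        by (intro mult_right_mono majorant_ge \<tau>_nonneg norm_ge_zero)
      also have "\<dots> \<le> norm (?X k *v v)"
        using bound[of k] by (simp add: newton_bound_def)
      finally show ?thesis .
    qed
    ultimately show ?thesis
      by (intro LIMSEQ_le_const) auto
  qed
  then have "sigma_min Xs \<ge> \<gamma>0"
    by (simp add: le_sigma_min_iff)
  moreover have "invertible Xs" if "\<gamma>0 > 0"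
    using that low by (rule invertible_of_norm_lower_bound)
  ultimately show ?thesis
    using inv lim Xs_comm Xs_square error unfolding \<tau>_def by blast
qed

end
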